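(* For $x\in[-1,1]$ and $y=(y_1,y_2)\in\mathbb R^2$ let $$h_1(x,y)=y_1,\quad h_2(x,y)=-y_1-2,\quad h_3(x,y)=y_2,\quad h_4(x,y)=-y_2-2,\quad h_5(x,y)=y_1+y_2+x,$$ and let $\mathcal Y(x)=\{y\in\mathbb R^2: h_i(x,y)\le 0,\ i=1,\dots,5\}$. There exist a compact set $K\subset\mathbb R^2$ with $\mathcal Y(x)\subset\operatorname{int}(K)$ for all $x\in[-1,1]$ and $\epsilon>0$ such that the following holds: for any $C^2$ functions $r_1,\dots,r_5:[-1,1]\times\mathbb R^2\to\mathbb R$ with $$|r_i(x,y)|\le\epsilon,\quad \|\nabla_y r_i(x,y)\|\le\epsilon,\quad \|\nabla^2_{yy}r_i(x,y)\|_{\rm op}\le\epsilon\qquad\text{for all }x\in[-1,1],\ y\in K,\ i=1,\dots,5,$$ and $\widetilde h_i=h_i+r_i$, there exist $x^\ast\in[-1,1]$ and a point $y^\ast\in\mathbb R^2$ feasible for the perturbed constraints at $x^\ast$ (i.e. $\widetilde h_i(x^\ast,y^\ast)\le 0$ for all $i$) such that LICQ for the perturbed constraints fails at $(x^\ast,y^\ast)$.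
   Context: LICQ for constraints $\widetilde h_i(x,y)\le 0$ holds at a feasible point $(x,y)$ if the vectors $\{\nabla_y\widetilde h_i(x,y): \widetilde h_i(x,y)=0\}$ are linearly independent; otherwise it fails at $(x,y)$. *)

theory Defs
  imports "HOL-Analysis.Analysis"
begin

text \<open>
  Twice continuously differentiable on \<open>S\<close>, with derivatives taken relative to \<open>S\<close>, hence one-sided
  at boundary points. Meant for convex \<open>S\<close> with nonempty interior, where they are unique.
\<close>

definition C2_on ::
  "'a set \<Rightarrow> ('a::real_normed_vector \<Rightarrow> 'b::real_normed_vector) \<Rightarrow> bool" where
  "C2_on S f \<longleftrightarrow>
     (\<exists>(f' :: 'a \<Rightarrow> 'a \<Rightarrow>\<^sub>L 'b) (f'' :: 'a \<Rightarrow> 'a \<Rightarrow>\<^sub>L 'a \<Rightarrow>\<^sub>L 'b).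
        (\<forall>z\<in>S. (f has_derivative blinfun_apply (f' z)) (at z within S)) \<and>
        (\<forall>z\<in>S. (f' has_derivative blinfun_apply (f'' z)) (at z within S)) \<and>
        continuous_on S f'')"

definition grad :: "('a::real_inner \<Rightarrow> real) \<Rightarrow> 'a \<Rightarrow> 'a" where
  "grad f y = (THE D. GDERIV f y :> D)"

definition hess :: "('a::real_inner \<Rightarrow> real) \<Rightarrow> 'a \<Rightarrow> 'a \<Rightarrow> 'a" where
  "hess f y = frechet_derivative (grad f) (at y)"

definition feasible_set :: "'i set \<Rightarrow> ('i \<Rightarrow> 'p \<Rightarrow> 'a \<Rightarrow> real) \<Rightarrow> 'p \<Rightarrow> 'a set" where
  "feasible_set I g x = {y. \<forall>i\<in>I. g i x y \<le> 0}"

definition active_set :: "'i set \<Rightarrow> ('i \<Rightarrow> 'p \<Rightarrow> 'a \<Rightarrow> real) \<Rightarrow> 'p \<Rightarrow> 'a \<Rightarrow> 'i set" where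
  "active_set I g x y = {i \<in> I. g i x y = 0}"

text \<open>
  The active gradients are independent as an indexed family: two distinct active constraints
  with equal gradients violate LICQ.
\<close>

definition LICQ ::
  "'i set \<Rightarrow> ('i \<Rightarrow> 'p \<Rightarrow> 'a::real_inner \<Rightarrow> real) \<Rightarrow> 'p \<Rightarrow> 'a \<Rightarrow> bool" where
  "LICQ I g x y \<longleftrightarrow>
     inj_on (\<lambda>i. grad (g i x) y) (active_set I g x y) \<and>
     independent ((\<lambda>i. grad (g i x) y) ` active_set I g x y)"

text \<open>Constraints are numbered 1 to 5; the value at other indices is irrelevant.\<close>

definition h :: "nat \<Rightarrow> real \<Rightarrow> real ^ 2 \<Rightarrow> real" where
  "h i x y =
     (if i = 1 then y $ 1
      else if i = 2 then - (y $ 1) - 2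
      else if i = 3 then y $ 2
      else if i = 4 then - (y $ 2) - 2
      else if i = 5 then y $ 1 + y $ 2 + x
      else 0)"

end

theory Submission
  imports Defs
begin

text \<open>
  At $x = 0$ the three constraints $h_1, h_3, h_5$ are simultaneously active at $y = 0$, and three
  gradients in the plane are dependent. This triple point is transversal in the joint unknown
  $(x, y)$, so it survives small perturbations: solving the perturbed equations for
  $y_1$, $y_2$ and $x$ gives a continuous self-map of a small box, and Brouwer's theorem yields a
  fixed point.
\<close>

lemma C2_on_imp_continuous_on:
  assumes "C2_on S f"
  shows "continuous_on S f"
  using assms unfolding C2_on_def
  by (meson has_derivative_continuous_on)

text \<open>A pure counting obstruction: since \<open>LICQ\<close> asks for injectivity of the
  indexed gradients, more than \<open>DIM('a)\<close> active indices would give more than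
  \<open>DIM('a)\<close> independent vectors, whatever the gradients are.\<close>

lemma not_LICQ_if_card_active_gt_dim:
  fixes g :: "'i \<Rightarrow> 'p \<Rightarrow> 'a::euclidean_space \<Rightarrow> real"
  assumes "A \<subseteq> active_set I g x y" and "card A > DIM('a)"
  shows "\<not> LICQ I g x y"
proof
  assume L: "LICQ I g x y"
  let ?G = "\<lambda>i. grad (g i x) y"
  have inj: "inj_on ?G A"
    using L assms(1) unfolding LICQ_def by (meson inj_on_subset)
  have "independent (?G ` A)"
    using L assms(1) unfolding LICQ_def by (meson independent_mono image_mono)
  then have "card (?G ` A) \<le> DIM('a)"
    by (rule independent_bound[THEN conjunct2])
  with inj assms(2) show False by (simp add: card_image)
qed

text \<open>The first four constraints alone confine \<open>y\<close> to the square with both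
  coordinates in [-2, 0], uniformly in \<open>x\<close>; a margin of 1 on each side makes the box
  open.\<close>

lemma feasible_set_h_subset_box:
  "feasible_set {1..5} h x \<subseteq> box (vec (-3)) (vec 1)"
proof
  fix y assume y: "y \<in> feasible_set {1..5} h x"
  then have "h i x y \<le> 0" if "i \<in> {1..5}" for i
    using that by (simp add: feasible_set_def)
  from this[of 1] this[of 2] this[of 3] this[of 4]
  show "y \<in> box (vec (-3)) (vec 1)"
    by (simp add: h_def mem_box_cart forall_2)
qed

lemma perturbed_triple_point:
  fixes r :: "nat \<Rightarrow> real \<Rightarrow> real ^ 2 \<Rightarrow> real"
  defines "B \<equiv> cbox (vec (-(1/4))) (vec (1/4)) :: (real ^ 2) set"
  assumes cont: "\<And>i. i \<in> {1, 3, 5} \<Longrightarrow> continuous_on ({-1..1} \<times> B) (\<lambda>(x, y). r i x y)"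
    and bound: "\<And>i x y. i \<in> {1, 3, 5} \<Longrightarrow> x \<in> {-1..1} \<Longrightarrow> y \<in> B \<Longrightarrow> \<bar>r i x y\<bar> \<le> 1/4"
  obtains x y where "x \<in> {-1..1}" "y \<in> B"
    "\<And>i. i \<in> {1, 3, 5} \<Longrightarrow> h i x y + r i x y = 0"
proof -
  \<comment> \<open>The first component solves constraint 5 for \<open>x\<close>; entries 1 and 2 of
    the vector solve constraints 1 and 3 for the coordinates of \<open>y\<close>. Fixed points are
    thus exactly the common zeros.\<close>
  define T :: "real \<times> (real ^ 2) \<Rightarrow> real \<times> (real ^ 2)" where
    "T = (\<lambda>z. (- (snd z $ 1) - snd z $ 2 - r 5 (fst z) (snd z),
               \<chi> j. - r (if j = 1 then 1 else 3) (fst z) (snd z)))"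
  let ?S = "{-1..1::real} \<times> B"
  have c: "continuous_on ?S (\<lambda>z. r i (fst z) (snd z))" if "i \<in> {1, 3, 5}" for i
    using cont[OF that] by (simp add: case_prod_unfold)
  have "continuous_on ?S (\<lambda>z. - r (if j = 1 then 1 else 3) (fst z) (snd z))" for j :: 2
    by (intro continuous_on_minus c) auto
  then have contT: "continuous_on ?S T"
    unfolding T_def by (intro continuous_intros c continuous_on_vec_lambda) auto
  have B_iff: "y \<in> B \<longleftrightarrow> \<bar>y $ 1\<bar> \<le> 1/4 \<and> \<bar>y $ 2\<bar> \<le> 1/4" for y
    by (auto simp: B_def mem_box_cart forall_2)
  have maps: "T \<in> ?S \<rightarrow> ?S"
  proof
    fix z assume z: "z \<in> ?S"
    then have b: "\<bar>r i (fst z) (snd z)\<bar> \<le> 1/4" if "i \<in> {1, 3, 5}" for i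
      using bound[OF that] by auto
    from z have "\<bar>snd z $ 1\<bar> \<le> 1/4" "\<bar>snd z $ 2\<bar> \<le> 1/4"
      by (auto simp: B_iff)
    \<comment> \<open>Three terms of size at most 1/4 sum to at most 3/4 < 1.\<close>
    with b[of 5] have "fst (T z) \<in> {-1..1}"
      unfolding T_def fst_conv atLeastAtMost_iff by simp linarith
    \<comment> \<open>The half-width of \<open>B\<close> equals the bound on \<open>r\<close>, so
      the box is mapped into itself.\<close>
    moreover have "snd (T z) \<in> B"
      using b[of 1] b[of 3] by (simp add: T_def B_iff)
    ultimately show "T z \<in> ?S" by (simp add: mem_Times_iff)
  qed
  have "0 \<in> B" by (simp add: B_iff)
  then have "?S \<noteq> {}" by auto
  moreover have "compact ?S" "convex ?S"
    by (auto simp: B_def intro: compact_Times convex_Times)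
  ultimately obtain z where z: "z \<in> ?S" "T z = z"
    using brouwer[OF _ _ _ contT] maps by blast
  \<comment> \<open>Only the leftmost \<open>z\<close> is replaced by \<open>T z\<close>; rewriting
    the right-hand sides too would nest \<open>T\<close>.\<close>
  have eqs: "fst z = - (snd z $ 1) - snd z $ 2 - r 5 (fst z) (snd z)"
    "snd z $ 1 = - r 1 (fst z) (snd z)" "snd z $ 2 = - r 3 (fst z) (snd z)"
    by (subst (1) z(2)[symmetric], simp add: T_def)+
  show thesis
  proof
    show "fst z \<in> {-1..1}" "snd z \<in> B"
      using z(1) by auto
    show "h i (fst z) (snd z) + r i (fst z) (snd z) = 0" if "i \<in> {1, 3, 5}" for i
      using that eqs by (auto simp: h_def)
  qed
qed

theorem mainTheorem3:
  "\<exists>K :: (real ^ 2) set. compact K \<and>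
     (\<forall>x\<in>{-1..1}. feasible_set {1..5} h x \<subseteq> interior K) \<and>
     (\<exists>\<epsilon>::real. \<epsilon> > 0 \<and>
        (\<forall>r :: nat \<Rightarrow> real \<Rightarrow> real ^ 2 \<Rightarrow> real.
           (\<forall>i\<in>{1..5}. C2_on ({-1..1} \<times> UNIV) (\<lambda>(x, y). r i x y)) \<and>
           (\<forall>x\<in>{-1..1}. \<forall>y\<in>K. \<forall>i\<in>{1..5}.
              \<bar>r i x y\<bar> \<le> \<epsilon> \<and>
              norm (grad (r i x) y) \<le> \<epsilon> \<and>
              onorm (hess (r i x) y) \<le> \<epsilon>) \<longrightarrow>
           (\<exists>x\<in>{-1..1}. \<exists>y.
              y \<in> feasible_set {1..5} (\<lambda>i x y. h i x y + r i x y) x \<and>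
              \<not> LICQ {1..5} (\<lambda>i x y. h i x y + r i x y) x y)))"
proof (intro exI conjI ballI allI impI; (elim conjE)?)
  let ?K = "cbox (vec (-3)) (vec 1) :: (real ^ 2) set"
  show "compact ?K" by simp
  show "feasible_set {1..5} h x \<subseteq> interior ?K" for x
    using feasible_set_h_subset_box by (simp add: interior_cbox)
  \<comment> \<open>This fixes \<epsilon> = 1/4, the bound under which the triple point
    persists.\<close>
  show "(1/4 :: real) > 0" by simp
  fix r :: "nat \<Rightarrow> real \<Rightarrow> real ^ 2 \<Rightarrow> real"
  assume C2: "\<forall>i\<in>{1..5}. C2_on ({-1..1} \<times> UNIV) (\<lambda>(x, y). r i x y)"
    and small: "\<forall>x\<in>{-1..1}. \<forall>y\<in>?K. \<forall>i\<in>{1..5}. \<bar>r i x y\<bar> \<le> 1/4 \<and>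
      norm (grad (r i x) y) \<le> 1/4 \<and> onorm (hess (r i x) y) \<le> 1/4"
  let ?B = "cbox (vec (-(1/4))) (vec (1/4)) :: (real ^ 2) set"
  have bound: "\<bar>r i x y\<bar> \<le> 1/4" if "i \<in> {1..5}" "x \<in> {-1..1}" "y \<in> ?B" for i x y
  proof -
    have "y \<in> ?K"
      using that(3) by (simp add: mem_box_cart forall_2)
    with small that show ?thesis by blast
  qed
  have cont: "continuous_on ({-1..1} \<times> ?B) (\<lambda>(x, y). r i x y)" if "i \<in> {1..5}" for i
    using C2_on_imp_continuous_on[OF C2[rule_format, OF that]]
    by (rule continuous_on_subset) auto
  have idx: "i \<in> {1..5}" if "i \<in> {1, 3, 5}" for i :: nat
    using that by auto
  obtain x y where x: "x \<in> {-1..1}" and y: "y \<in> ?B"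
    and act: "\<And>i. i \<in> {1, 3, 5} \<Longrightarrow> h i x y + r i x y = 0"
    using perturbed_triple_point[of r, OF cont[OF idx] bound[OF idx]] by blast
  let ?g = "\<lambda>i x y. h i x y + r i x y"
  have "{1, 3, 5} \<subseteq> active_set {1..5} ?g x y"
    using act by (auto simp: active_set_def)
  \<comment> \<open>Three active indices exceed the dimension 2.\<close>
  then have "\<not> LICQ {1..5} ?g x y"
    by (rule not_LICQ_if_card_active_gt_dim) simp
  moreover have "?g i x y \<le> 0" if i: "i \<in> {1..5}" for i
  proof -
    \<comment> \<open>On \<open>?B\<close> the functions \<open>h 2\<close> and \<open>h 4\<close>
      are at most 1/4 - 2, so a perturbation of at most 1/4 leaves them negative.\<close>
    have inactive: "?g i x y \<le> 0" if "i = 2 \<or> i = 4"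
      using that y bound[OF i x y] by (auto simp: h_def mem_box_cart forall_2)
    have "i \<in> {1, 3, 5} \<or> i = 2 \<or> i = 4"
      using i by auto
    with act inactive show ?thesis by fastforce
  qed
  ultimately show "\<exists>x\<in>{-1..1}. \<exists>y. y \<in> feasible_set {1..5} ?g x \<and> \<not> LICQ {1..5} ?g x y"
    using x unfolding feasible_set_def by blast
qed

end
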